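(* Let $q\geq 2$ and let $1<p_1<\dots<p_q$ be integers such that the $\mathbb{Q}$-linear span of $\log p_1,\dots,\log p_q$ in $\mathbb{R}$ has dimension at least $2$. Let $N$ be an integer greater than $q\frac{\log p_q}{\log p_1}$, and let $z$ be the point of the $2q$-dimensional torus $T^{2q}=\mathbb{R}^{2q}/\mathbb{Z}^{2q}$ defined by the coordinates modulo $1$ $$z=(z_1,\dots,z_{2q})=\left(\sum_{k\geq 1}p_1^{-N^{2k}},\dots,\sum_{k\geq 1}p_q^{-N^{2k}},\ \sum_{k\geq 1}p_1^{-N^{2k+1}},\dots,\sum_{k\geq 1}p_q^{-N^{2k+1}}\right).$$ Let $\Omega$ be the abelian semigroup of endomorphisms of $T^{2q}$ generated by the maps $w\mapsto p_i w \bmod \mathbb{Z}^{2q}$, $1\leq i\leq q$. Then $z$ is not contained in any proper rational affine subspace of $T^{2q}$, but its orbit $\Omega z$ is not dense in $T^{2q}$.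
   Context: A proper rational affine subspace of $T^{m}=\mathbb{R}^m/\mathbb{Z}^m$ is the image in $T^m$ of a set $r+V$, where $r\in\mathbb{Q}^m$ and $V\subsetneq\mathbb{R}^m$ is a linear subspace spanned by vectors of $\mathbb{Q}^m$. *)

theory Defs
  imports "HOL-Analysis.Analysis"
begin

(* The torus of dimension CARD('m), as the quotient of real vectors by integer vectors. *)

definition int_vec_rel :: "real ^ 'm \<Rightarrow> real ^ 'm \<Rightarrow> bool" where
  "int_vec_rel x y \<longleftrightarrow> (\<forall>i. x $ i - y $ i \<in> \<int>)"

quotient_type 'm torus = "real ^ 'm" / int_vec_rel
  morphisms rep_torus to_torus
proof (rule equivpI)
  show "reflp (int_vec_rel :: real ^ 'm \<Rightarrow> _)"
    by (simp add: reflp_def int_vec_rel_def)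
  show "symp (int_vec_rel :: real ^ 'm \<Rightarrow> _)"
    unfolding symp_def int_vec_rel_def by (metis Ints_minus minus_diff_eq)
  show "transp (int_vec_rel :: real ^ 'm \<Rightarrow> _)"
  proof (rule transpI)
    fix x y w :: "real ^ 'm"
    assume xy: "int_vec_rel x y" and yw: "int_vec_rel y w"
    show "int_vec_rel x w"
      unfolding int_vec_rel_def
    proof
      fix i
      have "(x $ i - y $ i) + (y $ i - w $ i) \<in> \<int>"
        using xy yw unfolding int_vec_rel_def by (intro Ints_add) auto
      then show "x $ i - w $ i \<in> \<int>" by simp
    qed
  qed
qed

(* Quotient topology: U is open iff its preimage in real vectors is open. *)
instantiation torus :: (finite) topological_space
begin

definition open_torus :: "'a torus set \<Rightarrow> bool" where
  "open_torus U \<longleftrightarrow> open (to_torus -` U)"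

instance
proof
  show "open (UNIV :: 'a torus set)"
    by (simp add: open_torus_def)
  show "open (S \<inter> T)" if "open S" "open T" for S T :: "'a torus set"
    using that by (simp add: open_torus_def open_Int)
  show "open (\<Union>K)" if "\<forall>S\<in>K. open S" for K :: "'a torus set set"
    using that by (simp add: open_torus_def vimage_Union open_UN)
qed

end

lift_definition torus_mult :: "nat \<Rightarrow> ('m::finite) torus \<Rightarrow> 'm torus"
  is "\<lambda>n x. real n *\<^sub>R x"
proof -
  fix n :: nat and x y :: "real ^ 'm"
  assume "int_vec_rel x y"
  then have "real n * (x $ i - y $ i) \<in> \<int>" for i
    unfolding int_vec_rel_def by (intro Ints_mult) auto
  then show "int_vec_rel (real n *\<^sub>R x) (real n *\<^sub>R y)"
    unfolding int_vec_rel_def by (simp add: right_diff_distrib)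
qed

definition rational_vec :: "real ^ 'm \<Rightarrow> bool" where
  "rational_vec x \<longleftrightarrow> (\<forall>i. x $ i \<in> \<rat>)"

definition proper_rational_affine_subspace :: "('m::finite) torus set \<Rightarrow> bool" where
  "proper_rational_affine_subspace A \<longleftrightarrow>
     (\<exists>r V. rational_vec r \<and> V \<noteq> UNIV \<and> (\<exists>B. (\<forall>b\<in>B. rational_vec b) \<and> V = span B) \<and>
        A = to_torus ` {r + v | v. v \<in> V})"

(* Closure under composition; the identity map is not adjoined. *)
inductive_set generated_semigroup :: "('a \<Rightarrow> 'a) set \<Rightarrow> ('a \<Rightarrow> 'a) set"
  for S :: "('a \<Rightarrow> 'a) set" where
  gen: "f \<in> S \<Longrightarrow> f \<in> generated_semigroup S"
| comp: "f \<in> generated_semigroup S \<Longrightarrow> g \<in> generated_semigroup S \<Longrightarrow>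
    f \<circ> g \<in> generated_semigroup S"

(* The real numbers as a vector space over the rationals. *)
global_interpretation rat_real: vector_space "\<lambda>(r::rat) (x::real). of_rat r * x"
  defines rat_span = rat_real.span
    and rat_dim = rat_real.dim
  by unfold_locales (simp_all add: algebra_simps of_rat_add of_rat_mult)

(* In the index type 'q + 'q, the left summand carries the first CARD('q) coordinates and the
   right summand the last CARD('q) ones. *)
definition z_point :: "('q::finite \<Rightarrow> nat) \<Rightarrow> nat \<Rightarrow> ('q + 'q) torus" where
  "z_point p N = to_torus (\<chi> j. case j of
       Inl i \<Rightarrow> (\<Sum>\<^sub>\<infinity>k\<in>{1..}. real (p i) powi (- int (N ^ (2 * k))))
     | Inr i \<Rightarrow> (\<Sum>\<^sub>\<infinity>k\<in>{1..}. real (p i) powi (- int (N ^ (2 * k + 1)))))"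

end

theory Submission
  imports Defs
begin

text \<open>
  The coordinates of \<open>z\<close> together with \<open>1\<close> are linearly independent over the rationals: multiply a
  relation by a common denominator and by \<open>(p\<^sub>1 \<cdots> p\<^sub>q) ^ (N ^ n)\<close>. The terms up to \<open>n\<close> become integers, and
  as \<open>p\<^sub>1 \<cdots> p\<^sub>q < p\<^sub>1 ^ N\<close> the remaining tail tends to \<open>0\<close>, so it vanishes for large \<open>n\<close>. Comparing consecutive
  tails leaves relations \<open>\<Sum>\<^sub>i c\<^sub>i p\<^sub>i ^ (- (N ^ n)) = 0\<close> for all large \<open>n\<close> of one parity, in which the smallest
  \<open>p\<^sub>i\<close> dominates.

  For the orbit, let \<open>M = p\<^sub>1 ^ a\<^sub>1 \<cdots> p\<^sub>q ^ a\<^sub>q\<close>, let \<open>p\<^sub>i ^ a\<^sub>i\<close> be its largest factor, so that \<open>M \<le> p\<^sub>i ^ (q a\<^sub>i)\<close>,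
  and let \<open>L\<close> be least with \<open>a\<^sub>i < N ^ L\<close>. In the series in \<open>p\<^sub>i\<close> whose exponents \<open>N ^ m\<close> have \<open>m\<close> of the parity opposite
  to \<open>L\<close>, \<open>M\<close> makes the terms with \<open>m < L\<close> integral, and those with \<open>m > L\<close> stay small because \<open>q < N\<close>.
  So every orbit point has a coordinate in \<open>[0, 1/2]\<close> modulo \<open>1\<close>, and the orbit misses the open set of
  points all of whose coordinates lie in \<open>(1/2, 1)\<close> modulo \<open>1\<close>.
\<close>

section \<open>Rational functionals and common denominators\<close>

text \<open>Take a real vector \<open>y\<close> orthogonal to the span and apply a rational-linear functional from the reals to the
  rationals to each of its coordinates.\<close>
lemma rational_functional_of_proper_span:
  fixes B :: "(real ^ 'm::finite) set"
  assumes "\<forall>b\<in>B. rational_vec b" "span B \<noteq> UNIV"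
  obtains c :: "'m \<Rightarrow> rat" where "\<exists>j. c j \<noteq> 0" "\<And>v. v \<in> span B \<Longrightarrow> (\<Sum>j\<in>UNIV. of_rat (c j) * v $ j) = 0"
proof -
  obtain y where y: "y \<noteq> 0" "\<And>x. x \<in> span B \<Longrightarrow> y \<bullet> x = 0"
    using span_not_UNIV_orthogonal[OF assms(2)] by blast
  obtain j0 where j0: "y $ j0 \<noteq> 0" using y(1) by (auto simp: vec_eq_iff)
  interpret VP: vector_space_pair "\<lambda>(r::rat) (x::real). of_rat r * x" "(*) :: rat \<Rightarrow> rat \<Rightarrow> rat"
    by unfold_locales (simp_all add: algebra_simps)
  \<comment> \<open>Prescribing the value 1 at a nonzero coordinate of \<open>y\<close> keeps the
    resulting rational vector from vanishing.\<close>
  have "rat_real.independent {y $ j0}"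
    using j0 by simp
  then obtain g :: "real \<Rightarrow> rat" where g: "Vector_Spaces.linear (\<lambda>(r::rat) (x::real). of_rat r * x) (*) g"
    "\<forall>x\<in>{y $ j0}. g x = 1"
    using VP.linear_independent_extend[of "{y $ j0}" "\<lambda>_. 1"] by blast
  interpret g: Vector_Spaces.linear "\<lambda>(r::rat) (x::real). of_rat r * x" "(*) :: rat \<Rightarrow> rat \<Rightarrow> rat" g by fact
  \<comment> \<open>\<open>g\<close> is only rational-linear, so the relation is proved for the
    rational generators; it then passes to their real span because it is real-linear in
    \<open>v\<close>.\<close>
  have "(\<Sum>j\<in>UNIV. of_rat (g (y $ j)) * v $ j) = 0" if "v \<in> span B" for v
    using that
  proof (induction rule: span_induct_alt)
    case base
    then show ?case by simp
  next
    case (step c x v)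
    have "\<forall>j. \<exists>r. x $ j = of_rat r"
      using assms(1) step unfolding rational_vec_def by (metis Rats_cases)
    then obtain r where r: "\<And>j. x $ j = of_rat (r j)" by metis
    have "(\<Sum>j\<in>UNIV. of_rat (r j) * y $ j) = 0"
      using y(2)[OF span_base[OF step(1)]] by (simp add: inner_vec_def r mult.commute)
    then have "g (\<Sum>j\<in>UNIV. of_rat (r j) * y $ j) = 0" by (simp add: g.zero)
    then have "(\<Sum>j\<in>UNIV. r j * g (y $ j)) = 0"
      by (simp add: g.sum g.scale)
    then have "(of_rat (\<Sum>j\<in>UNIV. r j * g (y $ j)) :: real) = 0" by simp
    then have "(\<Sum>j\<in>UNIV. of_rat (g (y $ j)) * x $ j) = 0"
      by (simp add: of_rat_sum of_rat_mult r mult.commute)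
    moreover have "(\<Sum>j\<in>UNIV. of_rat (g (y $ j)) * (c *\<^sub>R x + v) $ j) =
       c * (\<Sum>j\<in>UNIV. of_rat (g (y $ j)) * x $ j) + (\<Sum>j\<in>UNIV. of_rat (g (y $ j)) * v $ j)"
      by (simp add: algebra_simps sum.distrib sum_distrib_left)
    ultimately show ?case using step by simp
  qed
  moreover have "g (y $ j0) \<noteq> 0" using g(2) by simp
  ultimately show thesis using that[of "\<lambda>j. g (y $ j)"] by blast
qed

lemma common_denominator:
  assumes "finite A" "\<And>x. x \<in> A \<Longrightarrow> f x \<in> (\<rat> :: real set)"
  obtains D :: nat where "D > 0" "\<And>x. x \<in> A \<Longrightarrow> real D * f x \<in> \<int>"
proof -
  have "\<exists>D::nat. D > 0 \<and> (\<forall>x\<in>A. real D * f x \<in> \<int>)"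
    using assms
  proof (induction)
    case empty
    then show ?case by (intro exI[of _ 1]) auto
  next
    case (insert a A)
    then obtain D :: nat where D: "D > 0" "\<forall>x\<in>A. real D * f x \<in> \<int>" by auto
    from insert.prems[of a] obtain m n where mn: "n \<noteq> 0" "\<bar>f a\<bar> = real m / real n"
      by (auto elim: Rats_abs_nat_div_natE)
    have "real n * f a \<in> \<int>"
    proof (cases "f a \<ge> 0")
      case False
      then have "real n * f a = - real m" using mn by (simp add: field_simps)
      then show ?thesis by simp
    next
      case True
      then have "real n * f a = real m" using mn by (simp add: field_simps)
      then show ?thesis by simp
    qed
    then have "real D * (real n * f a) \<in> \<int>" by (rule Ints_mult[OF Ints_of_nat])
    moreover have "real n * (real D * f x) \<in> \<int>" if "x \<in> A" for x
      using D that by (auto intro: Ints_mult[OF Ints_of_nat])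
    ultimately show ?case using D mn by (intro exI[of _ "D * n"]) (auto simp: mult_ac)
  qed
  then show ?thesis using that by blast
qed

section \<open>Integrality and domination arguments for sequences\<close>

text \<open>A scaled tail is the scaled full sum minus scaled initial terms, hence an integer. Being
  eventually smaller than 1 in absolute value, it vanishes, and two consecutive vanishing tails
  differ by a single term of \<open>h\<close>.\<close>

lemma eventually_zero_if_scaled_tails_small:
  fixes h :: "nat \<Rightarrow> real"
  assumes "summable h" "\<And>n. D n \<noteq> 0"
    and "\<And>n m. m \<le> n \<Longrightarrow> D n * h m \<in> \<int>" "\<And>n. D n * suminf h \<in> \<int>"
    and "(\<lambda>n. D n * (\<Sum>m. h (m + Suc n))) \<longlonglongrightarrow> 0"
  shows "\<forall>\<^sub>F n in sequentially. h n = 0"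
proof -
  define t where "t n = (\<Sum>m. h (m + Suc n))" for n
  have t: "t n = suminf h - (\<Sum>m\<le>n. h m)" for n
    unfolding t_def lessThan_Suc_atMost[symmetric]
    using suminf_split_initial_segment[OF assms(1), of "Suc n"] by simp
  have int: "D n * t n \<in> \<int>" for n
    unfolding t right_diff_distrib sum_distrib_left using assms(3,4) by (intro Ints_diff Ints_sum) auto
  have "\<forall>\<^sub>F n in sequentially. \<bar>D n * t n\<bar> < 1"
    using assms(5) unfolding t_def[symmetric] tendsto_iff by (auto simp: dist_real_def)
  then have ev: "\<forall>\<^sub>F n in sequentially. t n = 0"
  proof eventually_elim
    case (elim n)
    then have "D n * t n = 0" using int Ints_nonzero_abs_less1 by blast
    then show ?case using assms(2) by simp
  qed
  then have "\<forall>\<^sub>F n in sequentially. t (Suc n) = 0"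
    by (subst eventually_sequentially_Suc)
  with ev have "\<forall>\<^sub>F n in sequentially. h (Suc n) = 0"
    by eventually_elim (simp add: t)
  then show ?thesis using eventually_sequentially_Suc by blast
qed

text \<open>Let \<open>k\<close> be the least index with nonzero coefficient. Multiplying the
  relation by \<open>p k ^ e n\<close> turns every other term into a null sequence, and the limit
  says \<open>c k = 0\<close>.\<close>

lemma exponential_sum_coefficients_zero:
  fixes p :: "'q::{finite, linorder} \<Rightarrow> nat" and c :: "'q \<Rightarrow> real"
  assumes "strict_mono p" "\<And>i. 0 < p i" "filterlim e at_top sequentially"
    and "\<forall>\<^sub>F n in sequentially. (\<Sum>i\<in>UNIV. c i * (1 / real (p i)) ^ e n) = 0"
  shows "c i = 0"
proof (rule ccontr)
  assume "c i \<noteq> 0"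
  define k where "k = Min {i. c i \<noteq> 0}"
  have "k \<in> {i. c i \<noteq> 0}" unfolding k_def using \<open>c i \<noteq> 0\<close> by (intro Min_in) auto
  then have k: "c k \<noteq> 0" by simp
  have le: "k \<le> i" if "c i \<noteq> 0" for i unfolding k_def using that by simp
  have lim: "(\<lambda>n. c i * (real (p k) / real (p i)) ^ e n) \<longlonglongrightarrow> (if i = k then c k else 0)" for i
  proof -
    consider "i = k" | "c i = 0" "i \<noteq> k" | "k < i" using le[of i] by fastforce
    then show ?thesis
    proof cases
      case 3
      then have "real (p k) / real (p i) < 1" using assms(1,2) by (simp add: strict_mono_def)
      then have "(\<lambda>n. (real (p k) / real (p i)) ^ n) \<longlonglongrightarrow> 0" by (intro LIMSEQ_power_zero) auto
      then have "(\<lambda>n. (real (p k) / real (p i)) ^ e n) \<longlonglongrightarrow> 0"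
        using assms(3) by (rule filterlim_compose)
      then have "(\<lambda>n. c i * (real (p k) / real (p i)) ^ e n) \<longlonglongrightarrow> 0"
        by (rule tendsto_mult_right_zero)
      then show ?thesis using 3 by simp
    qed (use assms(2)[of k] in auto)
  qed
  have "(\<lambda>n. \<Sum>i\<in>UNIV. c i * (real (p k) / real (p i)) ^ e n) \<longlonglongrightarrow> (\<Sum>i\<in>UNIV. if i = k then c k else 0)"
    by (intro tendsto_sum lim)
  then have "(\<lambda>n. \<Sum>i\<in>UNIV. c i * (real (p k) / real (p i)) ^ e n) \<longlonglongrightarrow> c k"
    by simp
  moreover have "\<forall>\<^sub>F n in sequentially. (\<Sum>i\<in>UNIV. c i * (real (p k) / real (p i)) ^ e n) = 0"
    using assms(4)
  proof eventually_elim
    case (elim n)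
    have "(\<Sum>i\<in>UNIV. c i * (real (p k) / real (p i)) ^ e n) =
        real (p k) ^ e n * (\<Sum>i\<in>UNIV. c i * (1 / real (p i)) ^ e n)"
      by (simp add: sum_distrib_left power_divide mult.commute)
    then show ?case using elim by simp
  qed
  then have "(\<lambda>n. \<Sum>i\<in>UNIV. c i * (real (p k) / real (p i)) ^ e n) \<longlonglongrightarrow> 0"
    by (rule tendsto_eventually)
  ultimately have "c k = 0" by (rule LIMSEQ_unique)
  then show False using k by simp
qed

section \<open>Lacunary series and the coordinates of the point\<close>

text \<open>Padding with zeros off \<open>S\<close> lets the even and the odd series share one
  summation index, so that linear combinations of coordinates can be formed term by term.\<close>

definition lacunary :: "nat \<Rightarrow> nat \<Rightarrow> nat set \<Rightarrow> nat \<Rightarrow> real" where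
  "lacunary b N S m = (if m \<in> S then (1 / real b) ^ (N ^ m) else 0)"

lemma lacunary_nonneg: "lacunary b N S m \<ge> 0"
  by (simp add: lacunary_def)

lemma add_le_power_add:
  fixes N m k :: nat
  assumes "2 \<le> N"
  shows "N ^ m + k \<le> N ^ (m + k)"
proof (induction k)
  case (Suc k)
  have "1 \<le> N ^ (m + k)" using assms by (intro one_le_power) simp
  with Suc have "N ^ m + Suc k \<le> 2 * N ^ (m + k)" by linarith
  also have "\<dots> \<le> N * N ^ (m + k)" using assms by (rule mult_right_mono) simp
  finally show ?case by simp
qed simp

lemma self_le_power_exponent:
  fixes N m :: nat
  assumes "2 \<le> N"
  shows "m \<le> N ^ m"
  using add_le_power_add[OF assms, of 0 m] by simp

text \<open>Since \<open>N ^ (m + n)\<close> is at least \<open>N ^ n + m\<close>, a geometric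
  series dominates the terms from index \<open>n\<close> on. The majorant depends on
  \<open>c\<close> alone, so one bound serves all bases \<open>b \<ge> c\<close>.\<close>

lemma lacunary_le:
  assumes "1 \<le> c" "c \<le> b" "2 \<le> N"
  shows "lacunary b N S (m + n) \<le> (1 / real c) ^ (N ^ n) * (1 / real c) ^ m"
proof -
  have "N ^ n + m \<le> N ^ (m + n)"
    using add_le_power_add[OF assms(3), of n m] by (simp only: add.commute)
  then have "(1 / real c) ^ (N ^ (m + n)) \<le> (1 / real c) ^ (N ^ n + m)"
    using assms(1) by (intro power_decreasing) simp_all
  moreover have "1 / real b \<le> 1 / real c" using assms(1,2) by (intro frac_le) simp_all
  then have "(1 / real b) ^ (N ^ (m + n)) \<le> (1 / real c) ^ (N ^ (m + n))"
    by (intro power_mono) simp_all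
  ultimately have "(1 / real b) ^ (N ^ (m + n)) \<le> (1 / real c) ^ (N ^ n) * (1 / real c) ^ m"
    unfolding power_add[symmetric] by (rule order_trans[rotated])
  then show ?thesis unfolding lacunary_def
    by (cases "m + n \<in> S") (simp_all only: if_True if_False, simp)
qed

lemma summable_lacunary:
  assumes "2 \<le> b" "2 \<le> N"
  shows "summable (lacunary b N S)"
proof (rule summable_comparison_test')
  show "summable (\<lambda>m. (1 / real b) ^ (N ^ 0) * (1 / real b) ^ m)"
    using assms by (intro summable_mult summable_geometric) auto
  show "norm (lacunary b N S m) \<le> (1 / real b) ^ (N ^ 0) * (1 / real b) ^ m" if "m \<ge> 0" for m
    using lacunary_le[of b b N S m 0] assms lacunary_nonneg[of b N S m] by simp
qed

lemma infsum_lacunary: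
  assumes "2 \<le> b" "2 \<le> N" "inj_on e A"
  shows "(\<Sum>\<^sub>\<infinity>k\<in>A. real b powi (- int (N ^ e k))) = suminf (lacunary b N (e ` A))"
proof -
  have "lacunary b N (e ` A) summable_on UNIV"
    using summable_lacunary[OF assms(1,2)] lacunary_nonneg
    by (subst summable_on_UNIV_nonneg_real_iff) auto
  then have "suminf (lacunary b N (e ` A)) = infsum (lacunary b N (e ` A)) UNIV"
    by (intro sums_unique[symmetric] has_sum_imp_sums has_sum_infsum)
  also have "\<dots> = infsum (lacunary b N (e ` A)) (e ` A)"
    by (intro infsum_cong_neutral) (auto simp: lacunary_def)
  also have "\<dots> = infsum (lacunary b N (e ` A) \<circ> e) A"
    by (rule infsum_reindex[OF assms(3)])
  also have "\<dots> = (\<Sum>\<^sub>\<infinity>k\<in>A. real b powi (- int (N ^ e k)))"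
    unfolding power_int_minus power_int_of_nat
    by (intro infsum_cong) (simp add: lacunary_def power_one_over inverse_eq_divide)
  finally show ?thesis by simp
qed

text \<open>The bound 2 reflects that \<open>k\<close> starts at 1 in both sums: the even indices
  begin at 2 and the odd ones at 3.\<close>

primrec place :: "'q + 'q \<Rightarrow> nat set" where
  "place (Inl i) = {m. 2 \<le> m \<and> even m}"
| "place (Inr i) = {m. 2 \<le> m \<and> odd m}"

abbreviation coord :: "('q \<Rightarrow> nat) \<Rightarrow> nat \<Rightarrow> 'q + 'q \<Rightarrow> nat \<Rightarrow> real" where
  "coord p N j \<equiv> lacunary (p (case_sum id id j)) N (place j)"

lemma z_point_eq:
  fixes p :: "'q::finite \<Rightarrow> nat"
  assumes "\<And>i. 2 \<le> p i" "2 \<le> N"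
  shows "z_point p N = to_torus (\<chi> j. suminf (coord p N j))"
proof -
  have E: "{m. 2 \<le> m \<and> even m} = (\<lambda>k::nat. 2 * k) ` {1..}" by (auto elim!: evenE)
  have O: "{m. 2 \<le> m \<and> odd m} = (\<lambda>k::nat. 2 * k + 1) ` {1..}" by (auto elim!: oddE)
  show ?thesis
    unfolding z_point_def
  proof (intro arg_cong[of _ _ to_torus] vec_eq_iff[THEN iffD2] allI)
    fix j :: "'q + 'q"
    show "(\<chi> j. case j of
        Inl i \<Rightarrow> (\<Sum>\<^sub>\<infinity>k\<in>{1..}. real (p i) powi (- int (N ^ (2 * k))))
      | Inr i \<Rightarrow> (\<Sum>\<^sub>\<infinity>k\<in>{1..}. real (p i) powi (- int (N ^ (2 * k + 1))))) $ j =
      (\<chi> j. suminf (coord p N j)) $ j"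
      using infsum_lacunary[OF assms, of "\<lambda>k. 2 * k" "{1..}"]
        infsum_lacunary[OF assms, of "\<lambda>k. 2 * k + 1" "{1..}"]
      by (cases j) (simp_all only: E O inj_on_def vec_lambda_beta sum.case place.simps id_apply, simp_all)
  qed
qed

section \<open>Orbit points and their distance from integers\<close>

lemma generated_semigroup_torus_mult:
  fixes p :: "'q::finite \<Rightarrow> nat" and f :: "'m::finite torus \<Rightarrow> 'm torus"
  assumes "f \<in> generated_semigroup (range (\<lambda>i. torus_mult (p i)))"
  shows "\<exists>a. f = torus_mult (\<Prod>i\<in>UNIV. p i ^ a i)"
  using assms
proof induction
  case (gen f)
  then obtain i where i: "f = torus_mult (p i)" by auto
  have "(\<Prod>j\<in>UNIV. p j ^ (if j = i then 1 else 0)) = (\<Prod>j\<in>UNIV. if j = i then p j else 1)"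
    by (rule prod.cong) auto
  also have "\<dots> = p i" by simp
  finally show ?case using i by metis
next
  case (comp f g)
  then obtain a b where ab: "f = torus_mult (\<Prod>i\<in>UNIV. p i ^ a i)" "g = torus_mult (\<Prod>i\<in>UNIV. p i ^ b i)"
    by auto
  have mult: "torus_mult m (torus_mult n w) = torus_mult (m * n) w" for m n and w :: "'m torus"
    by transfer (simp add: int_vec_rel_def)
  have "f \<circ> g = torus_mult (\<Prod>i\<in>UNIV. p i ^ (a i + b i))"
    by (auto simp: ab mult power_add prod.distrib fun_eq_iff)
  then show ?case by (intro exI[of _ "\<lambda>i. a i + b i"])
qed

lemma prod_le_max_factor_power:
  fixes g :: "'q::finite \<Rightarrow> nat"
  obtains i where "(\<Prod>j\<in>UNIV. g j) \<le> g i ^ CARD('q)"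
proof -
  have "Max (range g) \<in> range g" by (intro Max_in) auto
  then obtain i where i: "g i = Max (range g)" by (metis rangeE)
  have "(\<Prod>j\<in>UNIV. g j) \<le> (\<Prod>j\<in>(UNIV::'q set). g i)"
    unfolding i by (intro prod_mono) auto
  then show ?thesis using that by simp
qed

text \<open>For \<open>m < L\<close>, minimality gives \<open>N ^ m \<le> a\<close>, so
  \<open>M\<close> clears the denominator. The index \<open>L\<close> is absent from
  \<open>S\<close>. For later \<open>m\<close>, the exponent \<open>N ^ m\<close> exceeds
  \<open>a * q\<close> by at least \<open>Suc m\<close>, which leaves at most
  \<open>(1/2) ^ Suc m\<close>.\<close>

lemma multiple_lacunary_near_integer:
  fixes b N M a q :: nat
  assumes b: "2 \<le> b" and q: "2 \<le> q" "q < N" and dvd: "b ^ a dvd M" and le: "M \<le> b ^ (a * q)"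
    and L: "L = (LEAST L. a < N ^ L)" and S: "L \<notin> S" "\<And>m. m \<in> S \<Longrightarrow> 2 \<le> m"
  obtains n :: int and t where "real M * suminf (lacunary b N S) = of_int n + t" "0 \<le> t" "t \<le> 1/2"
proof -
  have N: "3 \<le> N" using q by simp
  have ex: "a < N ^ L" unfolding L
    by (rule LeastI[of _ "Suc a"]) (use self_le_power_exponent[of N "Suc a"] N in auto)
  have least: "N ^ m \<le> a" if "m < L" for m
    using not_less_Least[of m "\<lambda>L. a < N ^ L"] that unfolding L by auto
  let ?f = "lacunary b N S"
  have sm: "summable ?f" using summable_lacunary b N by auto
  \<comment> \<open>The bound \<open>Suc m \<le> N ^ (m - 1)\<close> used below fails at
    \<open>m = 1\<close>, so the tail starts no earlier than 2; indices 0 and 1 lie outside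
    \<open>S\<close> and contribute zero to the integral part.\<close>
  define K where "K = max 2 (Suc L)"
  have int: "real M * ?f m \<in> \<int>" if "m < K" for m
  proof (cases "m \<in> S")
    case True
    then have "m < L" using that S by (force simp: K_def not_less less_Suc_eq)
    have "b ^ (N ^ m) dvd M" using least[OF \<open>m < L\<close>] dvd by (meson dvd_trans le_imp_power_dvd)
    then obtain k where "M = b ^ (N ^ m) * k" by auto
    then have "real M * ?f m = real k" using True b by (simp add: lacunary_def power_one_over)
    then show ?thesis by simp
  qed (simp add: lacunary_def)
  have small: "real M * ?f m \<le> (1/2) ^ Suc m" if "K \<le> m" for m
  proof (cases "m \<in> S")
    case True
    then have m: "L < m" "2 \<le> m" using that by (auto simp: K_def)
    have "N ^ L \<le> N ^ (m - 1)" using m N by (intro power_increasing) auto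
    with ex have "a \<le> N ^ (m - 1)" by simp
    then have "a * q \<le> N ^ (m - 1) * (N - 1)" using q by (intro mult_mono) auto
    \<comment> \<open>As \<open>q \<le> N - 1\<close>, the first summand absorbs the size of
      \<open>M\<close>, and the second supplies the decay.\<close>
    moreover have "N ^ m = N ^ (m - 1) * (N - 1) + N ^ (m - 1)"
      using m N by (cases m; cases N) (auto simp: algebra_simps)
    moreover have "Suc m \<le> N ^ (m - 1)"
    proof -
      have "N ^ 1 + (m - 2) \<le> N ^ (1 + (m - 2))" using N by (intro add_le_power_add) auto
      then have "N + (m - 2) \<le> N ^ (1 + (m - 2))" by (simp only: power_one_right)
      moreover have "1 + (m - 2) = m - 1" using m by simp
      ultimately have "N + (m - 2) \<le> N ^ (m - 1)" by metis
      then show ?thesis using N m by linarith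
    qed
    ultimately have ge: "a * q + Suc m \<le> N ^ m" by linarith
    have "real M * (1 / real b) ^ (N ^ m) \<le> real b ^ (a * q) * (1 / real b) ^ (a * q + Suc m)"
      using ge b le by (intro mult_mono power_decreasing) (auto simp flip: of_nat_power)
    also have "\<dots> = (1 / real b) ^ Suc m" using b by (simp add: power_add power_one_over)
    also have "\<dots> \<le> (1 / 2) ^ Suc m" using b by (intro power_mono) (auto simp: field_simps)
    finally show ?thesis using True by (simp add: lacunary_def)
  qed (simp add: lacunary_def)
  \<comment> \<open>The additional factor \<open>1/2\<close> brings the bound on the whole tail down
    from 1 to \<open>1/2\<close>.\<close>
  have small2: "real M * ?f (m + K) \<le> (1/2) ^ Suc m * (1/2)" for m
  proof -
    have "real M * ?f (m + K) \<le> (1/2) ^ Suc (m + K)" by (rule small) simp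
    also have "\<dots> \<le> (1/2) ^ Suc (Suc m)" by (intro power_decreasing) (auto simp: K_def)
    finally show ?thesis by simp
  qed
  have sm2: "summable (\<lambda>m. real M * ?f (m + K))"
    using sm by (intro summable_mult summable_ignore_initial_segment)
  define t where "t = (\<Sum>m. real M * ?f (m + K))"
  have "(\<Sum>m<K. real M * ?f m) \<in> \<int>" using int by (intro Ints_sum) auto
  then obtain n where n: "(\<Sum>m<K. real M * ?f m) = of_int n" by (auto elim: Ints_cases)
  have "real M * suminf ?f = (\<Sum>m. real M * ?f m)" using sm by (simp add: suminf_mult)
  also have "\<dots> = of_int n + t"
    using suminf_split_initial_segment[of "\<lambda>m. real M * ?f m" K] sm n by (simp add: t_def summable_mult)
  finally have "real M * suminf ?f = of_int n + t" .
  moreover have "0 \<le> t" unfolding t_def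
    using sm2 by (intro suminf_nonneg) (auto simp: lacunary_nonneg)
  moreover have "t \<le> 1 / 2"
  proof -
    have "t \<le> (\<Sum>m. (1/2) ^ Suc m * (1/2))" unfolding t_def
      using small2 sm2 by (intro suminf_le) auto
    also have "\<dots> = 1 / 2" using power_half_series by (intro sums_unique[symmetric]) (auto dest: sums_mult2[where c="1/2"])
    finally show ?thesis .
  qed
  ultimately show ?thesis using that by blast
qed

section \<open>Rational independence of the coordinates and 1\<close>

lemma Ints_power_times_inverse_power:
  fixes b Q k l :: nat
  assumes "b dvd Q" "0 < b" "l \<le> k"
  shows "real Q ^ k * (1 / real b) ^ l \<in> \<int>"
proof -
  obtain c where c: "Q = b * c" using assms(1) by auto
  have "real Q ^ k * (1 / real b) ^ l = real Q ^ (k - l) * (real Q / real b) ^ l"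
    using assms(3) by (simp add: power_divide flip: power_add)
  also have "\<dots> = real (Q ^ (k - l) * c ^ l)" using assms(2) by (simp add: c)
  finally show ?thesis by simp
qed

text \<open>The tail after index \<open>n\<close> is of order at most
  \<open>P ^ (- (N ^ Suc n))\<close>; scaled by \<open>Q ^ (N ^ n)\<close>, with \<open>Q\<close>
  the product of the bases, it is bounded by a constant times \<open>(Q / P ^ N) ^ (N ^ n)\<close>,
  which tends to 0. Asking for a rational value of the sum, not only 0, includes the constant 1 in
  the independence.\<close>

lemma coord_sums_rationally_independent:
  fixes p :: "'q::{finite, linorder} \<Rightarrow> nat" and c :: "'q + 'q \<Rightarrow> rat"
  assumes "strict_mono p" "2 \<le> P" "\<And>i. P \<le> p i" "2 \<le> N" "(\<Prod>i\<in>UNIV. p i) < P ^ N"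
    and rat: "(\<Sum>j\<in>UNIV. of_rat (c j) * suminf (coord p N j)) \<in> \<rat>"
  shows "c j = 0"
proof -
  define s where "s = (\<Sum>j\<in>UNIV. real_of_rat (c j) * suminf (coord p N j))"
  define h where "h m = (\<Sum>j\<in>UNIV. real_of_rat (c j) * coord p N j m)" for m
  define Q where "Q = (\<Prod>i\<in>UNIV. p i)"
  have p2: "2 \<le> p i" for i using assms(2,3) order_trans by blast
  have "x \<in> \<rat>" if "x \<in> insert s (range (\<lambda>j. real_of_rat (c j)))" for x
    using that rat unfolding s_def by auto
  then obtain D :: nat where "D > 0"
    "\<And>x. x \<in> insert s (range (\<lambda>j. real_of_rat (c j))) \<Longrightarrow> real D * x \<in> \<int>"
    using common_denominator[of "insert s (range (\<lambda>j. real_of_rat (c j)))" "\<lambda>x. x"] by auto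
  then have D: "D > 0" "real D * s \<in> \<int>" "\<And>j. real D * real_of_rat (c j) \<in> \<int>" by auto
  have sm: "summable (coord p N j)" for j using summable_lacunary p2 assms(4) by blast
  have sumh: "h sums s"
    unfolding h_def s_def by (intro sums_sum sums_mult summable_sums sm)
  have Qpos: "Q > 0" unfolding Q_def using p2 by (auto intro!: prod_pos simp: Suc_le_eq intro: less_le_trans[of 0 2])
  have "\<forall>\<^sub>F n in sequentially. h n = 0"
  \<comment> \<open>\<open>D\<close> clears the denominators of the coefficients and of
    \<open>s\<close>; as every \<open>p i\<close> divides \<open>Q\<close>, the power
    \<open>Q ^ (N ^ n)\<close> clears all terms up to index \<open>n\<close>.\<close>
  proof (rule eventually_zero_if_scaled_tails_small[where D = "\<lambda>n. real D * real Q ^ (N ^ n)"])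
    show "summable h" using sumh by (rule sums_summable)
    show "real D * real Q ^ N ^ n \<noteq> 0" for n using D Qpos by simp
    have "real Q ^ N ^ n * (real D * s) \<in> \<int>" for n using D(2) by (rule Ints_mult[rotated]) simp
    then show "real D * real Q ^ N ^ n * suminf h \<in> \<int>" for n
      using sumh by (simp add: sums_iff mult_ac)
    show "real D * real Q ^ N ^ n * h m \<in> \<int>" if "m \<le> n" for m n
    proof -
      have "N ^ m \<le> N ^ n" using that assms(4) by (intro power_increasing) auto
      moreover have "p i dvd Q" for i unfolding Q_def by (rule dvd_prodI) auto
      ultimately have "real Q ^ N ^ n * coord p N j m \<in> \<int>" for j
        using p2[of "case_sum id id j"] by (auto simp: lacunary_def intro!: Ints_power_times_inverse_power)
      then have "(\<Sum>j\<in>UNIV. (real D * real_of_rat (c j)) * (real Q ^ N ^ n * coord p N j m)) \<in> \<int>"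
        using D(3) by (intro Ints_sum) (rule Ints_mult)
      then show ?thesis by (simp add: h_def sum_distrib_left mult_ac)
    qed
    define C where "C = (\<Sum>j\<in>UNIV. \<bar>real_of_rat (c j)\<bar>)"
    define G where "G = (\<Sum>m. (1 / real P) ^ m)"
    have smG: "summable (\<lambda>m. (1 / real P) ^ m)" using assms(2) by (intro summable_geometric) auto
    have tail: "\<bar>\<Sum>m. h (m + Suc n)\<bar> \<le> C * (1 / real P) ^ (N ^ Suc n) * G" for n
    proof -
      have le: "norm (h (m + Suc n)) \<le> C * (1 / real P) ^ (N ^ Suc n) * (1 / real P) ^ m" for m
      proof -
        have "norm (h (m + Suc n)) \<le> (\<Sum>j\<in>UNIV. \<bar>real_of_rat (c j)\<bar> * ((1 / real P) ^ (N ^ Suc n) * (1 / real P) ^ m))"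
          unfolding h_def
          by (rule sum_norm_le, unfold real_norm_def abs_mult abs_of_nonneg[OF lacunary_nonneg], rule mult_left_mono)
             (use assms(2-4) in \<open>auto intro!: lacunary_le simp del: power_Suc add_Suc_right\<close>)
        then show ?thesis by (simp only: C_def sum_distrib_right mult.assoc)
      qed
      have "norm (\<Sum>m. h (m + Suc n)) \<le> (\<Sum>m. C * (1 / real P) ^ (N ^ Suc n) * (1 / real P) ^ m)"
        by (rule norm_suminf_le[OF le]) (intro summable_mult smG)
      also have "\<dots> = C * (1 / real P) ^ (N ^ Suc n) * G"
        unfolding G_def by (rule suminf_mult[OF smG])
      finally show ?thesis by simp
    qed
    show "(\<lambda>n. real D * real Q ^ N ^ n * (\<Sum>m. h (m + Suc n))) \<longlonglongrightarrow> 0"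
    proof (rule Lim_null_comparison)
      show "\<forall>\<^sub>F n in sequentially. norm (real D * real Q ^ N ^ n * (\<Sum>m. h (m + Suc n)))
          \<le> real D * C * G * (real Q / real P ^ N) ^ (N ^ n)"
      proof (rule always_eventually, rule allI)
        fix n
        have "norm (real D * real Q ^ N ^ n * (\<Sum>m. h (m + Suc n)))
            \<le> real D * real Q ^ N ^ n * (C * (1 / real P) ^ (N ^ Suc n) * G)"
          unfolding real_norm_def abs_mult using tail[of n] by (intro mult_mono) auto
        also have "(1 / real P) ^ (N ^ Suc n) = (1 / real P ^ N) ^ (N ^ n)"
          by (simp add: power_one_over power_mult)
        finally show "norm (real D * real Q ^ N ^ n * (\<Sum>m. h (m + Suc n)))
            \<le> real D * C * G * (real Q / real P ^ N) ^ (N ^ n)"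
          by (simp add: power_divide mult_ac)
      qed
      have "real Q < real (P ^ N)" using assms(5) unfolding Q_def of_nat_less_iff .
      then have "(\<lambda>n. (real Q / real P ^ N) ^ n) \<longlonglongrightarrow> 0"
        using assms(2) by (intro LIMSEQ_power_zero) auto
      moreover have "filterlim (\<lambda>n. N ^ n) at_top sequentially"
        by (rule filterlim_at_top_mono[OF filterlim_ident]) (use assms(4) self_le_power_exponent in auto)
      ultimately have "(\<lambda>n. (real Q / real P ^ N) ^ (N ^ n)) \<longlonglongrightarrow> 0"
        by (rule filterlim_compose)
      then show "(\<lambda>n. real D * C * G * (real Q / real P ^ N) ^ (N ^ n)) \<longlonglongrightarrow> 0"
        by (rule tendsto_mult_right_zero)
    qed
  qed
  then obtain n0 where n0: "\<And>n. n \<ge> n0 \<Longrightarrow> h n = 0" by (auto simp: eventually_sequentially)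
  \<comment> \<open>At an even index from 2 on only the first sum survives, at an odd one only the
    second, so each vanishing \<open>h m\<close> is a relation within one half of the
    coordinates.\<close>
  have split: "h m = (\<Sum>i\<in>UNIV. real_of_rat (c (Inl i)) * lacunary (p i) N (place (Inl i :: 'q + 'q)) m) +
      (\<Sum>i\<in>UNIV. real_of_rat (c (Inr i)) * lacunary (p i) N (place (Inr i :: 'q + 'q)) m)" for m
    unfolding h_def UNIV_sum by (subst sum.union_disjoint) (auto simp: sum.reindex)
  have e: "filterlim (\<lambda>k. N ^ e k) at_top sequentially" if "\<And>k. k \<le> e k" for e
    by (rule filterlim_at_top_mono[OF filterlim_ident])
       (intro always_eventually allI order_trans[OF that self_le_power_exponent[OF assms(4)]])
  have "real_of_rat (c (Inl i)) = 0" for i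
  proof (rule exponential_sum_coefficients_zero[OF assms(1)])
    show "filterlim (\<lambda>k. N ^ (2 * k)) at_top sequentially" by (rule e) simp
    \<comment> \<open>\<open>Suc n0\<close> rather than \<open>n0\<close> forces
      \<open>k \<ge> 1\<close>, so that \<open>2 * k\<close> lies in
      \<open>place (Inl i)\<close>.\<close>
    have "(\<Sum>i\<in>UNIV. real_of_rat (c (Inl i)) * (1 / real (p i)) ^ N ^ (2 * k)) = 0" if "k \<ge> Suc n0" for k
      using n0[of "2 * k"] that split[of "2 * k"] by (simp add: lacunary_def)
    then show "\<forall>\<^sub>F k in sequentially. (\<Sum>i\<in>UNIV. real_of_rat (c (Inl i)) * (1 / real (p i)) ^ N ^ (2 * k)) = 0"
      unfolding eventually_sequentially by blast
  qed (use p2 in \<open>auto intro: less_le_trans[of 0 2]\<close>)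
  moreover have "real_of_rat (c (Inr i)) = 0" for i
  proof (rule exponential_sum_coefficients_zero[OF assms(1)])
    show "filterlim (\<lambda>k. N ^ (2 * k + 1)) at_top sequentially" by (rule e) simp
    have "(\<Sum>i\<in>UNIV. real_of_rat (c (Inr i)) * (1 / real (p i)) ^ N ^ (2 * k + 1)) = 0" if "k \<ge> Suc n0" for k
      using n0[of "2 * k + 1"] that split[of "2 * k + 1"] by (simp add: lacunary_def)
    then show "\<forall>\<^sub>F k in sequentially. (\<Sum>i\<in>UNIV. real_of_rat (c (Inr i)) * (1 / real (p i)) ^ N ^ (2 * k + 1)) = 0"
      unfolding eventually_sequentially by blast
  qed (use p2 in \<open>auto intro: less_le_trans[of 0 2]\<close>)
  ultimately show ?thesis by (cases j) auto
qed

section \<open>From real vectors to the torus\<close>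

text \<open>A nonzero rational functional that kills the direction space is rational on every lift
  of a point of \<open>A\<close>, because the base point is rational and lifts differ by integer
  vectors.\<close>

lemma not_in_proper_rational_affine_subspace:
  fixes x :: "real ^ 'm::finite"
  assumes indep: "\<And>c j. (\<Sum>j\<in>UNIV. of_rat (c j) * x $ j) \<in> \<rat> \<Longrightarrow> c j = 0"
    and A: "proper_rational_affine_subspace A"
  shows "to_torus x \<notin> A"
proof
  assume "to_torus x \<in> A"
  then obtain r B v where r: "rational_vec r" and B: "span B \<noteq> UNIV" "\<forall>b\<in>B. rational_vec b"
    and v: "v \<in> span B" and x: "to_torus x = to_torus (r + v)"
    using A unfolding proper_rational_affine_subspace_def by blast
  obtain c where c: "\<exists>j. c j \<noteq> 0" "\<And>v. v \<in> span B \<Longrightarrow> (\<Sum>j\<in>UNIV. of_rat (c j) * v $ j) = 0"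
    using rational_functional_of_proper_span[OF B(2,1)] by metis
  have int: "x $ j - (r $ j + v $ j) \<in> \<int>" for j
    using x unfolding torus.abs_eq_iff int_vec_rel_def by simp
  have "(\<Sum>j\<in>UNIV. of_rat (c j) * x $ j) =
      (\<Sum>j\<in>UNIV. of_rat (c j) * (r $ j + (x $ j - (r $ j + v $ j)))) + (\<Sum>j\<in>UNIV. of_rat (c j) * v $ j)"
    by (simp add: algebra_simps flip: sum.distrib)
  also have "\<dots> \<in> \<rat>"
    unfolding c(2)[OF v] add_0_right
    using r subsetD[OF Ints_subset_Rats int]
    by (intro Rats_sum Rats_mult Rats_add) (simp_all add: rational_vec_def)
  finally have "c j = 0" for j by (rule indep)
  then show False using c(1) by simp
qed

text \<open>The sign of \<open>sin (2 * pi * t)\<close> detects on which side of \<open>1/2\<close> the fractional part of \<open>t\<close> lies.\<close>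
lemma closure_torus_not_UNIV:
  fixes X :: "'m::finite torus set"
  assumes "\<And>x. to_torus x \<in> X \<Longrightarrow> \<exists>j. 0 \<le> sin (2 * pi * x $ j)"
  shows "closure X \<noteq> UNIV"
proof -
  define V where "V = {x :: real ^ 'm. \<forall>j. sin (2 * pi * x $ j) < 0}"
  have sin_eq: "sin (2 * pi * x) = sin (2 * pi * y)" if int: "x - y \<in> \<int>" for x y :: real
  proof -
    obtain n where "x - y = of_int n" using int by (elim Ints_cases)
    then have "x = y + of_int n" by simp
    then have "2 * pi * x = 2 * pi * y + 2 * pi * of_int n" by (simp add: distrib_left)
    then show ?thesis by (simp add: sin_add)
  qed
  have "y \<in> V" if "int_vec_rel x y" "x \<in> V" for x y
  proof -
    have "sin (2 * pi * x $ j) = sin (2 * pi * y $ j)" for j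
      by (rule sin_eq) (use that in \<open>simp add: int_vec_rel_def\<close>)
    then show ?thesis using that by (simp add: V_def)
  qed
  \<comment> \<open>\<open>V\<close> is saturated, so in the quotient topology its image is open as
    soon as \<open>V\<close> is.\<close>
  then have "to_torus -` (to_torus ` V) = V"
    by (fastforce simp: torus.abs_eq_iff dest: equivp_symp[OF torus_equivp])
  moreover have "open V"
    unfolding V_def Collect_all_eq by (intro open_INT ballI open_Collect_less continuous_intros) auto
  ultimately have "open (to_torus ` V)" by (simp add: open_torus_def)
  moreover have "(\<chi> j. 3 / 4) \<in> V"
  proof -
    have "2 * pi * (3 / 4) = 3 / 2 * pi" by simp
    then have "sin (2 * pi * (3 / 4)) = -1" by (simp only: sin_3over2_pi)
    then show ?thesis unfolding V_def by (simp del: sin_3over2_pi)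
  qed
  moreover have "to_torus ` V \<inter> X = {}"
    using assms by (auto simp: V_def) (meson not_le)
  ultimately have "to_torus ` V \<inter> closure X = {}" "to_torus ` V \<noteq> {}"
    using open_Int_closure_eq_empty by blast+
  then show ?thesis by auto
qed

theorem theorem2:
  fixes p :: "'q::{finite, linorder} \<Rightarrow> nat"
    and N :: nat
  assumes "CARD('q) \<ge> 2"
    and "\<And>i. 1 < p i"
    and "strict_mono p"
    and "rat_dim (rat_span (range (\<lambda>i. ln (real (p i))))) \<ge> 2"
    and "real N > real CARD('q) * (ln (real (p (Max UNIV))) / ln (real (p (Min UNIV))))"
  shows "(\<nexists>A. proper_rational_affine_subspace A \<and> z_point p N \<in> A) \<and>
         closure {f (z_point p N) | f. f \<in> generated_semigroup (range (\<lambda>i. torus_mult (p i)))} \<noteq> UNIV"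
proof
  define P where "P = p (Min UNIV)"
  define R where "R = p (Max UNIV)"
  define q where "q = CARD('q)"
  have p2: "2 \<le> p i" for i using assms(2)[of i] by simp
  have P: "P \<le> p i" and R: "p i \<le> R" for i
    unfolding P_def R_def by (simp_all add: strict_mono_less_eq[OF assms(3)])
  have P2: "2 \<le> P" and R2: "2 \<le> R" unfolding P_def R_def using p2 by auto
  have lnP: "0 < ln (real P)" using P2 by simp
  \<comment> \<open>This amounts to \<open>R ^ q < P ^ N\<close>. It yields both
    \<open>q < N\<close>, used for the orbit, and the bound on the product of the bases, used for
    independence.\<close>
  have N: "real q * ln (real R) < real N * ln (real P)"
    using assms(5) lnP unfolding P_def[symmetric] R_def[symmetric] q_def[symmetric]
    by (simp add: field_simps)
  have "ln (real P) \<le> ln (real R)" using P[of "Max UNIV"] P2 unfolding R_def by simp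
  then have "real q * ln (real P) \<le> real q * ln (real R)" by (intro mult_left_mono) auto
  with N have "real q * ln (real P) < real N * ln (real P)" by linarith
  then have qN: "q < N" using lnP by simp
  have "ln (real R ^ q) < ln (real P ^ N)" using N P2 R2 by (simp add: ln_realpow)
  then have "real R ^ q < real P ^ N" using P2 R2 by simp
  then have RP: "R ^ q < P ^ N" by (simp flip: of_nat_power)
  have "(\<Prod>i\<in>UNIV. p i) \<le> (\<Prod>i\<in>(UNIV::'q set). R)" using R by (intro prod_mono) auto
  then have prod: "(\<Prod>i\<in>UNIV. p i) < P ^ N" using RP by (simp add: q_def)
  have q2: "2 \<le> q" and N2: "2 \<le> N" using assms(1) qN by (simp_all add: q_def)
  define x :: "real ^ ('q + 'q)" where "x = (\<chi> j. suminf (coord p N j))"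
  have z: "z_point p N = to_torus x" unfolding x_def by (rule z_point_eq[OF p2 N2])
  have "c j = 0" if "(\<Sum>j\<in>UNIV. of_rat (c j) * x $ j) \<in> \<rat>" for c j
    using coord_sums_rationally_independent[OF assms(3) P2 P N2 prod] that by (simp add: x_def)
  then show "\<nexists>A. proper_rational_affine_subspace A \<and> z_point p N \<in> A"
    unfolding z using not_in_proper_rational_affine_subspace by blast
  show "closure {f (z_point p N) | f. f \<in> generated_semigroup (range (\<lambda>i. torus_mult (p i)))} \<noteq> UNIV"
  proof (rule closure_torus_not_UNIV)
    fix y
    assume "to_torus y \<in> {f (z_point p N) | f. f \<in> generated_semigroup (range (\<lambda>i. torus_mult (p i)))}"
    then obtain a where "to_torus y = torus_mult (\<Prod>i\<in>UNIV. p i ^ a i) (to_torus x)"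
      using generated_semigroup_torus_mult unfolding z by blast
    moreover define M where "M = (\<Prod>i\<in>UNIV. p i ^ a i)"
    ultimately have y: "int_vec_rel y (real M *\<^sub>R x)"
      by (simp add: torus_mult.abs_eq torus.abs_eq_iff)
    obtain i where i: "M \<le> (p i ^ a i) ^ q"
      using prod_le_max_factor_power[of "\<lambda>i. p i ^ a i"] unfolding M_def q_def by blast
    define L where "L = (LEAST L. a i < N ^ L)"
    \<comment> \<open>The half is chosen so that the critical index \<open>L\<close> does not occur
      in its series.\<close>
    define j where "j = (if even L then Inr i else Inl i)"
    have j: "case_sum id id j = i" "L \<notin> place j" "\<And>m. m \<in> place j \<Longrightarrow> 2 \<le> m"
      unfolding j_def by (auto split: if_splits)
    have "p i ^ a i dvd M" unfolding M_def by (rule dvd_prodI) auto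
    moreover have "M \<le> p i ^ (a i * q)" using i by (simp add: power_mult)
    ultimately obtain n :: int and t where t: "real M * suminf (lacunary (p i) N (place j)) = of_int n + t" "0 \<le> t" "t \<le> 1/2"
      using multiple_lacunary_near_integer[OF p2 q2 qN _ _ L_def j(2,3)] by metis
    have "y $ j - real M * x $ j \<in> \<int>" using y by (simp add: int_vec_rel_def)
    then have "y $ j - (of_int n + t) \<in> \<int>" by (simp add: x_def j(1) t(1))
    then obtain k where "y $ j - (of_int n + t) = of_int k" by (elim Ints_cases)
    then have "y $ j = t + of_int (n + k)" by simp
    then have "2 * pi * y $ j = 2 * pi * t + 2 * pi * of_int (n + k)" by (simp only: distrib_left)
    then have "sin (2 * pi * y $ j) = sin (2 * pi * t)"
      by (simp only: sin_add sin_int_2pin cos_int_2pin mult_1_right mult_zero_right add_0_right)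
    also have "\<dots> \<ge> 0" using t by (intro sin_ge_zero) auto
    finally show "\<exists>j. 0 \<le> sin (2 * pi * y $ j)" by blast
  qed
qed

end
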